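(* Let $\lambda\in\mathbb{C}\setminus\mathbb{Z}$, let $p\in\mathbb{Z}_{\ge 0}$, and let $$\chi(z)=\sum_{n=-p}^{\infty}\chi_{-n}z^{n-1}\in\mathbb{C}((z))$$ satisfy $\chi_p\neq 0$ and, in the case $p=0$, also $\chi_0\in\mathbb{C}\setminus\mathbb{Z}$. Then $F(\tfrac{\lambda}{z},\chi)$ is an irreducible $\mathcal{V}$-module.
   Context: $F$: the Clifford algebra $CL$ is the complex associative algebra generated by $\Psi^{\pm}(r)$, $r\in\frac12+\mathbb{Z}$, with relations $\{\Psi^{\pm}(r),\Psi^{\mp}(s)\}=\delta_{r+s,0}$, $\{\Psi^{\pm}(r),\Psi^{\pm}(s)\}=0$. $F$ is the irreducible $CL$-module generated by a vector $\mathbf 1$ with $\Psi^{\pm}(r)\mathbf 1=0$ for $r>0$; it is a simple vertex superalgebra generated by the fields $\Psi^{\pm}(z)=\sum_{n\in\mathbb{Z}}\Psi^{\pm}(n+\frac12)z^{-n-1}$. $M(0)=\mathbb{C}[\gamma^{+}(n),\gamma^{-}(n)\mid n<0]$ is the commutative vertex algebra generated by the fields $\gamma^{\pm}(z)=\sum_{n<0}\gamma^{\pm}(n)z^{-n-1}$. For $\chi^{\pm}(z)=\sum_{n\in\mathbb{Z}}\chi^{\pm}_n z^{-n-1}\in\mathbb{C}((z))$, $M(0,\chi^+,\chi^-)$ is the one-dimensional $M(0)$-module on which $\gamma^{\pm}(z)$ acts as $\chi^{\pm}(z)$, i.e. $\gamma^\pm(n)$ acts as $\chi^\pm_n$ ($n\in\mathbb{Z}$).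 $\mathcal{V}$ is the vertex subalgebra of the vertex superalgebra $F\otimes M(0)$ generated by $\tau^{\pm}=(\Psi^{\pm}(-\frac32)+\gamma^{\pm}(-1)\Psi^{\pm}(-\frac12))\mathbf 1$, $j=\frac12(\gamma^+(-1)-\gamma^-(-1))\mathbf 1$, $\nu=\frac14(2\gamma^+(-1)\gamma^-(-1)+\gamma^+(-2)+\gamma^-(-2))\mathbf 1$. The modes of the fields $G^{\pm}(z)=Y(\tau^\pm,z)=\sum_n G^{\pm}(n+\frac12)z^{-n-2}$, $S(z)=Y(\nu,z)=\sum_n S(n)z^{-n-2}$, $T(z)=Y(j,z)=\sum_n T(n)z^{-n-1}$ span a Lie superalgebra $\mathcal{A}$ in which $S(n),T(n)$ are central, $\{G^\pm(r),G^\pm(s)\}=0$ and $\{G^+(r),G^-(s)\}=2S(r+s)+(r-s)T(r+s)-(r^2-\frac14)\delta_{r+s,0}$. $F(\chi^+,\chi^-):=F\otimes M(0,\chi^+,\chi^-)$ is an $F\otimes M(0)$-module and hence a $\mathcal{V}$-module. Identified with $F$ as a vector space, the action is $G^{\pm}(i-\frac12)=-i\Psi^{\pm}(i-\frac12)+\sum_{k}\chi^{\pm}_{-k}\Psi^{\pm}(k+i-\frac12)$ ($i\in\mathbb{Z}$), while $T(z)$ and $S(z)$ act as the scalar series $\frac12(\chi^+-\chi^-)$ and $\frac14(2\chi^+\chi^-+\partial_z\chi^++\partial_z\chi^-)$. A $\mathcal{V}$-module is irreducible iff it is irreducible under $\mathcal{A}$. *)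

theory Defs
  imports
    Complex_Main
    "HOL-Library.Poly_Mapping"
    "HOL-Library.Groups_Big_Fun"
    "HOL-Library.FSet"
    "HOL-Library.Multiset"
    "HOL-Library.Product_Lexorder"
    "HOL-Computational_Algebra.Formal_Laurent_Series"
begin

definition cscale :: "complex \<Rightarrow> ('b \<Rightarrow>\<^sub>0 complex) \<Rightarrow> ('b \<Rightarrow>\<^sub>0 complex)" where
  "cscale c v = Poly_Mapping.map ((*) c) v"

lemma lookup_cscale [simp]: "Poly_Mapping.lookup (cscale c v) b = c * Poly_Mapping.lookup v b"
  by (simp add: cscale_def Poly_Mapping.map.rep_eq when_def)

global_interpretation pm: vector_space "cscale :: complex \<Rightarrow> ('b \<Rightarrow>\<^sub>0 complex) \<Rightarrow> _"
  by standard (auto intro!: poly_mapping_eqI simp: lookup_add algebra_simps)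

definition lin_ext :: "('b \<Rightarrow> ('c \<Rightarrow>\<^sub>0 complex)) \<Rightarrow> ('b \<Rightarrow>\<^sub>0 complex) \<Rightarrow> ('c \<Rightarrow>\<^sub>0 complex)" where
  "lin_ext f v = (\<Sum>b\<in>Poly_Mapping.keys v. cscale (Poly_Mapping.lookup v b) (f b))"

definition tensor ::
    "('b \<Rightarrow>\<^sub>0 complex) \<Rightarrow> ('c \<Rightarrow>\<^sub>0 complex) \<Rightarrow> (('b \<times> 'c) \<Rightarrow>\<^sub>0 complex)" where
  "tensor u v = lin_ext (\<lambda>b. lin_ext (\<lambda>c. Poly_Mapping.single (b, c) 1) v) u"

text \<open>A field \<open>a(z) = \<Sum>n. a\<^sub>n z\<^bsup>-n-1\<^esup>\<close> is given by its sequence of modes \<open>a\<^sub>n\<close>.\<close>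

type_synonym 'b field_modes = "int \<Rightarrow> ('b \<Rightarrow>\<^sub>0 complex) \<Rightarrow> ('b \<Rightarrow>\<^sub>0 complex)"

definition id_field :: "'b field_modes" where
  "id_field n v = (if n = -1 then v else 0)"

text \<open>
  The \<open>n\<close>-th product of two fields,
  \<open>Res\<^sub>w ((w - z)\<^sup>n a(w) b(z) - \<epsilon> (-z + w)\<^sup>n b(z) a(w))\<close>,
  where \<open>(w - z)\<^sup>n\<close> is expanded in nonnegative powers of \<open>z\<close>, \<open>(-z + w)\<^sup>n\<close> in nonnegative powers
  of \<open>w\<close>, and \<open>\<epsilon>\<close> is \<open>-1\<close> if both fields are odd and \<open>1\<close> otherwise. For fields, only finitely
  many of the terms below are nonzero on a given vector.
\<close>

definition field_prod ::
    "complex \<Rightarrow> 'b field_modes \<Rightarrow> int \<Rightarrow> 'b field_modes \<Rightarrow> 'b field_modes" where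
  "field_prod eps a n b m v =
     Sum_any (\<lambda>j::nat. cscale ((-1) ^ j * ((of_int n :: complex) gchoose j))
       (a (n - int j) (b (m + int j) v)
        - cscale (eps * (-1) powi n) (b (m + n - int j) (a (int j) v))))"

text \<open>
  The superscript of \<open>\<Psi>\<^sup>\<plusminus>\<close>, \<open>\<gamma>\<^sup>\<plusminus>\<close> is a boolean, \<open>True\<close> for \<open>+\<close>. A pair \<open>(s, k)\<close> labels the
  creation operator \<open>\<Psi>\<^sup>s(-k-1/2)\<close> in \<open>F\<close> and the variable \<open>\<gamma>\<^sup>s(-k-1)\<close> in \<open>M(0)\<close>.
  The basis vector of \<open>F\<close> indexed by \<open>{x\<^sub>1 < \<dots> < x\<^sub>r}\<close> is \<open>x\<^sub>1 \<cdots> x\<^sub>r 1\<close> (the order is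
  lexicographic), and the basis vector of \<open>M(0)\<close> indexed by a multiset is the corresponding monomial.
\<close>

type_synonym label = "bool \<times> nat"
type_synonym F_basis = "label fset"
type_synonym M0_basis = "label multiset"
type_synonym F_space = "F_basis \<Rightarrow>\<^sub>0 complex"
type_synonym M0_space = "M0_basis \<Rightarrow>\<^sub>0 complex"
type_synonym FM_space = "(F_basis \<times> M0_basis) \<Rightarrow>\<^sub>0 complex"

definition pass_sign :: "label \<Rightarrow> F_basis \<Rightarrow> complex" where
  "pass_sign x A = (-1) ^ card {y \<in> fset A. y < x}"

definition create :: "label \<Rightarrow> F_basis \<Rightarrow> F_space" where
  "create x A = (if x |\<in>| A then 0 else Poly_Mapping.single (finsert x A) (pass_sign x A))"

definition annihilate :: "label \<Rightarrow> F_basis \<Rightarrow> F_space" where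
  "annihilate x A = (if x |\<in>| A then Poly_Mapping.single (A |-| {|x|}) (pass_sign x A) else 0)"

text \<open>
  \<open>psi s n\<close> is \<open>\<Psi>\<^sup>s(n+1/2)\<close>, so that \<open>psi s\<close> is the field \<open>\<Psi>\<^sup>s(z) = \<Sum>n. \<Psi>\<^sup>s(n+1/2) z\<^bsup>-n-1\<^esup>\<close>.
  For \<open>n \<ge> 0\<close> it removes the creation operator of the opposite superscript that it pairs with.
\<close>

definition psi_basis :: "bool \<Rightarrow> int \<Rightarrow> F_basis \<Rightarrow> F_space" where
  "psi_basis s n A = (if n < 0 then create (s, nat (- n - 1)) A else annihilate (\<not> s, nat n) A)"

definition psi :: "bool \<Rightarrow> F_basis field_modes" where
  "psi s n = lin_ext (psi_basis s n)"

definition gamma_basis :: "bool \<Rightarrow> int \<Rightarrow> M0_basis \<Rightarrow> M0_space" where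
  "gamma_basis s n B =
     (if n < 0 then Poly_Mapping.single (add_mset (s, nat (- n - 1)) B) 1 else 0)"

definition psi_FM :: "bool \<Rightarrow> (F_basis \<times> M0_basis) field_modes" where
  "psi_FM s n = lin_ext (\<lambda>(A, B). tensor (psi_basis s n A) (Poly_Mapping.single B 1))"

definition gamma_FM :: "bool \<Rightarrow> (F_basis \<times> M0_basis) field_modes" where
  "gamma_FM s n = lin_ext (\<lambda>(A, B). tensor (Poly_Mapping.single A 1) (gamma_basis s n B))"

definition vac :: FM_space where
  "vac = Poly_Mapping.single ({||}, {#}) 1"

text \<open>
  Given the fields \<open>psi_f s\<close>, \<open>gam_f s\<close> by which the generators \<open>\<Psi>\<^sup>s(-1/2)1\<close>, \<open>\<gamma>\<^sup>s(-1)1\<close> act on a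
  space, the vertex operator of an arbitrary vector of \<open>F \<otimes> M(0)\<close> is determined by
  \<open>Y(1, z) = id\<close> and \<open>Y(a\<^sub>n v, z) = Y(a, z)\<^sub>n Y(v, z)\<close> for a generator \<open>a\<close>; note that
  \<open>\<Psi>\<^sup>s(-k-1/2)\<close> and \<open>\<gamma>\<^sup>s(-k-1)\<close> are the modes of the generators with \<open>n = -k-1\<close>.
\<close>

primrec gamma_word :: "(bool \<Rightarrow> 'b field_modes) \<Rightarrow> label list \<Rightarrow> 'b field_modes" where
  "gamma_word gam_f [] = id_field"
| "gamma_word gam_f (x # xs) =
     field_prod 1 (gam_f (fst x)) (- int (snd x) - 1) (gamma_word gam_f xs)"

primrec psi_word ::
    "(bool \<Rightarrow> 'b field_modes) \<Rightarrow> 'b field_modes \<Rightarrow> label list \<Rightarrow> 'b field_modes" where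
  "psi_word psi_f b [] = b"
| "psi_word psi_f b (x # xs) =
     field_prod ((-1) ^ length xs) (psi_f (fst x)) (- int (snd x) - 1) (psi_word psi_f b xs)"

definition vertex_op ::
    "(bool \<Rightarrow> 'b field_modes) \<Rightarrow> (bool \<Rightarrow> 'b field_modes) \<Rightarrow> FM_space \<Rightarrow> 'b field_modes" where
  "vertex_op psi_f gam_f v n w =
     lin_ext (\<lambda>(A, B). psi_word psi_f (gamma_word gam_f (sorted_list_of_multiset B))
       (sorted_list_of_fset A) n w) v"

text \<open>\<open>Y_FM u n v\<close> is \<open>u\<^sub>n v\<close> in the vertex superalgebra \<open>F \<otimes> M(0)\<close>.\<close>

definition Y_FM :: "FM_space \<Rightarrow> (F_basis \<times> M0_basis) field_modes" where
  "Y_FM = vertex_op psi_FM gamma_FM"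

definition tau :: "bool \<Rightarrow> FM_space" where
  "tau s = psi_FM s (-2) vac + gamma_FM s (-1) (psi_FM s (-1) vac)"

definition jvec :: FM_space where
  "jvec = cscale (1/2) (gamma_FM True (-1) vac - gamma_FM False (-1) vac)"

definition nuvec :: FM_space where
  "nuvec = cscale (1/4) (cscale 2 (gamma_FM True (-1) (gamma_FM False (-1) vac))
     + gamma_FM True (-2) vac + gamma_FM False (-2) vac)"

definition vertex_subalgebra :: "FM_space set \<Rightarrow> bool" where
  "vertex_subalgebra U \<longleftrightarrow>
     pm.subspace U \<and> vac \<in> U \<and> (\<forall>u\<in>U. \<forall>v\<in>U. \<forall>n. Y_FM u n v \<in> U)"

definition calV :: "FM_space set" where
  "calV = vertex_subalgebra hull {tau True, tau False, jvec, nuvec}"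

text \<open>\<open>mode_of \<chi> n\<close> is the coefficient \<open>\<chi>\<^sub>n\<close> in \<open>\<chi>(z) = \<Sum>n. \<chi>\<^sub>n z\<^bsup>-n-1\<^esup>\<close>.\<close>

definition mode_of :: "complex fls \<Rightarrow> int \<Rightarrow> complex" where
  "mode_of \<chi> n = fls_nth \<chi> (- n - 1)"

text \<open>
  \<open>F \<otimes> M(0, \<chi>\<^sup>+, \<chi>\<^sup>-)\<close> is identified with \<open>F\<close>, the second factor being one-dimensional.
  \<open>Y_F \<chi>p \<chi>m\<close> is the resulting action of \<open>F \<otimes> M(0)\<close>.
\<close>

definition gamma_chi :: "complex fls \<Rightarrow> complex fls \<Rightarrow> bool \<Rightarrow> F_basis field_modes" where
  "gamma_chi \<chi>p \<chi>m s n v = cscale (mode_of (if s then \<chi>p else \<chi>m) n) v"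

definition Y_F :: "complex fls \<Rightarrow> complex fls \<Rightarrow> FM_space \<Rightarrow> F_basis field_modes" where
  "Y_F \<chi>p \<chi>m = vertex_op psi (gamma_chi \<chi>p \<chi>m)"

definition submodule_under :: "'v set \<Rightarrow> ('v \<Rightarrow> 'b field_modes) \<Rightarrow> ('b \<Rightarrow>\<^sub>0 complex) set \<Rightarrow> bool" where
  "submodule_under V Y W \<longleftrightarrow> pm.subspace W \<and> (\<forall>v\<in>V. \<forall>n. \<forall>w\<in>W. Y v n w \<in> W)"

text \<open>Submodules are not required to be graded by parity.\<close>

definition irreducible_under :: "'v set \<Rightarrow> ('v \<Rightarrow> 'b field_modes) \<Rightarrow> bool" where
  "irreducible_under V Y \<longleftrightarrow>
     (UNIV :: ('b \<Rightarrow>\<^sub>0 complex) set) \<noteq> {0} \<and>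
     (\<forall>W. submodule_under V Y W \<longrightarrow> W = {0} \<or> W = UNIV)"

lemma lin_ext_superset:
  assumes "finite S" "Poly_Mapping.keys v \<subseteq> S"
  shows "lin_ext f v = (\<Sum>b\<in>S. cscale (Poly_Mapping.lookup v b) (f b))"
  unfolding lin_ext_def using assms
  by (intro sum.mono_neutral_left) (auto simp: in_keys_iff)

lemma lin_ext_add: "lin_ext f (u + v) = lin_ext f u + lin_ext f v"
proof -
  let ?S = "Poly_Mapping.keys u \<union> Poly_Mapping.keys v"
  have "Poly_Mapping.keys (u + v) \<subseteq> ?S" by (rule Poly_Mapping.keys_add)
  thus ?thesis
    by (simp add: lin_ext_superset[of ?S] lookup_add pm.scale_left_distrib sum.distrib)
qed

lemma lin_ext_cscale: "lin_ext f (cscale c v) = cscale c (lin_ext f v)"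
proof -
  have "Poly_Mapping.keys (cscale c v) \<subseteq> Poly_Mapping.keys v" by (auto simp: in_keys_iff)
  thus ?thesis
    by (simp add: lin_ext_superset[of "Poly_Mapping.keys v"] pm.scale_sum_right lin_ext_def[of f v])
qed

lemma lin_ext_zero [simp]: "lin_ext f 0 = 0" by (simp add: lin_ext_def)

lemma cscale_single [simp]: "cscale c (Poly_Mapping.single b d) = Poly_Mapping.single b (c * d)"
  by (intro poly_mapping_eqI) (simp add: lookup_single when_def)

lemma lin_ext_single [simp]: "lin_ext f (Poly_Mapping.single b c) = cscale c (f b)"
  by (cases "c = 0") (simp_all add: lin_ext_def)

lemma lin_ext_sum: "lin_ext f (\<Sum>i\<in>I. g i) = (\<Sum>i\<in>I. lin_ext f (g i))"
  by (induction I rule: infinite_finite_induct) (auto simp: lin_ext_add)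

lemma lin_ext_comp: "lin_ext f (lin_ext g v) = lin_ext (\<lambda>b. lin_ext f (g b)) v"
  by (simp add: lin_ext_def[of g] lin_ext_def[of "\<lambda>b. lin_ext f (g b)"] lin_ext_sum lin_ext_cscale)

lemma lin_ext_plus: "lin_ext f v + lin_ext g v = lin_ext (\<lambda>b. f b + g b) v"
  by (simp add: lin_ext_def sum.distrib pm.scale_right_distrib)

lemma lin_ext_id [simp]: "lin_ext (\<lambda>b. Poly_Mapping.single b 1) v = v"
  by (rule poly_mapping_eqI)
     (auto simp: lin_ext_def lookup_sum lookup_single when_def in_keys_iff if_distrib sum.delta cong: if_cong)

lemma pass_sign_insert:
  "x |\<notin>| A \<Longrightarrow> pass_sign y (finsert x A) = (if x < y then - pass_sign y A else pass_sign y A)"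
proof -
  assume x: "x |\<notin>| A"
  have "{z \<in> fset (finsert x A). z < y} =
        (if x < y then insert x {z \<in> fset A. z < y} else {z \<in> fset A. z < y})" by auto
  thus ?thesis using x by (simp add: pass_sign_def)
qed

lemma pass_sign_remove:
  assumes "x |\<in>| A"
  shows "pass_sign y (A |-| {|x|}) = (if x < y then - pass_sign y A else pass_sign y A)"
proof -
  have "pass_sign y (finsert x (A |-| {|x|})) = 
    (if x < y then - pass_sign y (A |-| {|x|}) else pass_sign y (A |-| {|x|}))"
    by (rule pass_sign_insert) auto
  moreover have "finsert x (A |-| {|x|}) = A" using assms by auto
  ultimately show ?thesis by (simp split: if_splits)
qed

lemma pass_sign_sq [simp]: "pass_sign x A * pass_sign x A = 1"
  by (simp add: pass_sign_def flip: power_mult_distrib)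

lemma single_uminus: "Poly_Mapping.single a (- c) = - Poly_Mapping.single a (c::complex)"
  by (rule poly_mapping_eqI) (simp add: lookup_single when_def)

lemma create_create:
  "lin_ext (create x) (create y A) + lin_ext (create y) (create x A) = 0"
proof (cases "x |\<in>| A \<or> y |\<in>| A \<or> x = y")
  case True
  thus ?thesis by (elim disjE) (simp_all add: create_def)
next
  case False
  have c: "finsert x (finsert y A) = finsert y (finsert x A)" by auto
  from False consider "x < y" "\<not> y < x" | "y < x" "\<not> x < y" by (metis neqE order_less_imp_not_less)
  thus ?thesis
    using False by cases (simp_all add: create_def c pass_sign_insert single_uminus mult.commute eq_commute)
qed

lemma annihilate_annihilate:
  "lin_ext (annihilate x) (annihilate y A) + lin_ext (annihilate y) (annihilate x A) = 0"
proof (cases "x |\<notin>| A \<or> y |\<notin>| A \<or> x = y")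
  case True
  thus ?thesis by (elim disjE) (simp_all add: annihilate_def)
next
  case False
  have c: "A |-| {|x|} |-| {|y|} = A |-| {|y|} |-| {|x|}" by auto
  from False consider "x < y" "\<not> y < x" | "y < x" "\<not> x < y" by (metis neqE order_less_imp_not_less)
  thus ?thesis
    using False by cases (simp_all add: annihilate_def c pass_sign_remove single_uminus mult.commute eq_commute)
qed

lemma create_annihilate:
  "lin_ext (create x) (annihilate y A) + lin_ext (annihilate y) (create x A) =
     (if x = y then Poly_Mapping.single A 1 else 0)"
proof (cases "x = y")
  case True
  thus ?thesis
    by (auto simp: create_def annihilate_def pass_sign_insert pass_sign_remove finsert_absorb)
next
  case False
  hence *: "finsert x A |-| {|y|} = finsert x (A |-| {|y|})" by auto
  from False have ne: "y \<noteq> x" by simp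
  consider "x |\<in>| A" | "y |\<notin>| A" | "x |\<notin>| A" "y |\<in>| A" by blast
  thus ?thesis
  proof cases
    case 1
    with False show ?thesis by (simp add: create_def annihilate_def)
  next
    case 2
    with False show ?thesis by (simp add: create_def annihilate_def)
  next
    case 3
    from False consider "x < y" "\<not> y < x" | "y < x" "\<not> x < y" by (metis neqE order_less_imp_not_less)
    thus ?thesis
    proof cases
      case 1
      with 3 False ne show ?thesis
        by (simp add: create_def annihilate_def * pass_sign_insert pass_sign_remove single_uminus mult.commute)
    next
      case 2
      with 3 False ne show ?thesis
        by (simp add: create_def annihilate_def * pass_sign_insert pass_sign_remove single_uminus mult.commute)
    qed
  qed
qed

lemma annihilate_create:
  "lin_ext (annihilate y) (create x A) + lin_ext (create x) (annihilate y A) =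
     (if x = y then Poly_Mapping.single A 1 else 0)"
  using create_annihilate[of x y A] by (simp add: add.commute)

text \<open>The relations of the Clifford algebra, for \<open>\<Psi>\<^sup>s(n+1/2)\<close> and \<open>\<Psi>\<^sup>t(m+1/2)\<close>.\<close>

lemma psi_anticommute:
  "psi s n (psi t m v) + psi t m (psi s n v) = (if s \<noteq> t \<and> n + m + 1 = 0 then v else 0)"
proof -
  have *: "lin_ext (psi_basis s n) (psi_basis t m A) + lin_ext (psi_basis t m) (psi_basis s n A) 
     = (if s \<noteq> t \<and> n + m + 1 = 0 then Poly_Mapping.single A 1 else 0)" for A
  proof (cases "n < 0"; cases "m < 0")
    assume "n < 0" "m < 0" thus ?thesis by (simp add: psi_basis_def[abs_def] create_create)
  next
    assume "\<not> n < 0" "\<not> m < 0" thus ?thesis by (simp add: psi_basis_def[abs_def] annihilate_annihilate)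
  next
    assume "n < 0" "\<not> m < 0" thus ?thesis by (auto simp add: psi_basis_def[abs_def] create_annihilate)
  next
    assume "\<not> n < 0" "m < 0" thus ?thesis by (auto simp add: psi_basis_def[abs_def] annihilate_create)
  qed
  have z: "lin_ext (\<lambda>b. 0) v = 0" by (simp add: lin_ext_def)
  have "psi s n (psi t m v) + psi t m (psi s n v) =
      lin_ext (\<lambda>A. if s \<noteq> t \<and> n + m + 1 = 0 then Poly_Mapping.single A 1 else 0) v"
    unfolding psi_def lin_ext_comp lin_ext_plus * ..
  also have "\<dots> = (if s \<noteq> t \<and> n + m + 1 = 0 then v else 0)"
  proof (cases "s \<noteq> t \<and> n + m + 1 = 0")
    case True
    show ?thesis unfolding if_P[OF True] by (rule lin_ext_id)
  next
    case False
    show ?thesis unfolding if_not_P[OF False] by (rule z)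
  qed
  finally show ?thesis .
qed

lemma psi_vacuum: "n \<ge> 0 \<Longrightarrow> psi s n (Poly_Mapping.single {||} 1) = 0"
  apply (subst psi_def) apply (subst lin_ext_single) apply (subst psi_basis_def) apply (subst annihilate_def) by simp

lemma psi_eventually_zero: "\<exists>N. \<forall>n\<ge>N. psi s n v = 0"
proof -
  have "\<exists>N. \<forall>n\<ge>N. psi_basis s n A = 0" for A
  proof -
    have "finite (snd ` fset A)" by simp
    then obtain N where N: "\<forall>x\<in>snd ` fset A. x < N"
      unfolding finite_nat_set_iff_bounded by blast
    have "psi_basis s n A = 0" if "n \<ge> int N" for n
    proof -
      have "(\<not> s, nat n) |\<notin>| A"
      proof
        assume "(\<not> s, nat n) |\<in>| A"
        hence "nat n \<in> snd ` fset A" by (metis image_eqI snd_conv)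
        with N that show False by fastforce
      qed
      thus ?thesis using that by (simp add: psi_basis_def annihilate_def)
    qed
    thus ?thesis by blast
  qed
  then obtain N where N: "\<And>A n. n \<ge> N A \<Longrightarrow> psi_basis s n A = 0" by metis
  define M where "M = Max (insert 0 (N ` Poly_Mapping.keys v))"
  have M: "N A \<le> M" if "A \<in> Poly_Mapping.keys v" for A
    unfolding M_def using that by (intro Max_ge) auto
  have "psi s n v = 0" if "n \<ge> M" for n
    unfolding psi_def lin_ext_def
  proof (rule sum.neutral, rule ballI)
    fix A assume "A \<in> Poly_Mapping.keys v"
    with M[of A] that have "psi_basis s n A = 0" by (intro N) simp
    thus "cscale (Poly_Mapping.lookup v A) (psi_basis s n A) = 0" by simp
  qed
  thus ?thesis by blast
qed

lemma psi_lin [simp]: "psi s n 0 = 0" "psi s n (u + v) = psi s n u + psi s n v"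
   "psi s n (cscale c v) = cscale c (psi s n v)"
  by (simp_all add: psi_def lin_ext_add lin_ext_cscale)

lemma minus_one_gchoose: "(-1::complex) gchoose j = (-1) ^ j"
  using gbinomial_minus[of "1::complex" j] binomial_gbinomial[of j j, where 'a=complex] by simp

lemma minus_two_gchoose: "(-2::complex) gchoose j = (-1) ^ j * of_nat (j + 1)"
proof -
  have "(2::complex) + of_nat j - 1 = of_nat (j + 1)" by simp
  moreover have "(j + 1) choose j = j + 1" by simp
  ultimately show ?thesis
    using gbinomial_minus[of "2::complex" j] binomial_gbinomial[of "j + 1" j, where 'a=complex] by metis
qed

lemma minus_one_sq: "(-1) ^ j * ((-1) ^ j * c) = (c :: complex)"
  by (simp add: mult.assoc[symmetric] flip: power_mult_distrib)

lemma field_prod_minus_one: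
  "field_prod 1 a (-1) b m v =
     Sum_any (\<lambda>j. a (- 1 - int j) (b (m + int j) v) + b (m - 1 - int j) (a (int j) v))"
proof -
  have "(-1 :: complex) ^ j * (-1) ^ j = 1" for j using minus_one_sq[of j 1] by simp
  thus ?thesis by (simp add: field_prod_def minus_one_gchoose algebra_simps)
qed

lemma Sum_any_int_split:
  fixes f :: "int \<Rightarrow> 'a::comm_monoid_add"
  assumes "finite {k. f k \<noteq> 0}"
  shows "Sum_any (\<lambda>j::nat. f (- 1 - int j) + f (int j)) = Sum_any f"
proof -
  have "finite ((\<lambda>k. nat \<bar>k\<bar>) ` {k. f k \<noteq> 0})" using assms by simp
  then obtain N where N: "\<forall>i\<in>(\<lambda>k. nat \<bar>k\<bar>) ` {k. f k \<noteq> 0}. i < N"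
    unfolding finite_nat_set_iff_bounded by blast
  have z: "f k = 0" if "\<bar>k\<bar> \<ge> int N" for k
    using N that by force
  have "Sum_any f = (\<Sum>k\<in>{- int N..<int N}. f k)"
  proof (rule Sum_any.expand_superset)
    show "{a. f a \<noteq> 0} \<subseteq> {- int N..<int N}" using z by (force simp: not_le[symmetric])
  qed simp
  moreover have "Sum_any (\<lambda>j::nat. f (- 1 - int j) + f (int j)) = (\<Sum>j<N. f (- 1 - int j) + f (int j))"
  proof (rule Sum_any.expand_superset)
    show "{j. f (- 1 - int j) + f (int j) \<noteq> 0} \<subseteq> {..<N}"
    proof
      fix j assume "j \<in> {j. f (- 1 - int j) + f (int j) \<noteq> 0}"
      hence "f (- 1 - int j) \<noteq> 0 \<or> f (int j) \<noteq> 0" by auto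
      thus "j \<in> {..<N}" using z[of "-1 - int j"] z[of "int j"] by force
    qed
  qed simp
  moreover have "(\<Sum>k\<in>{- int N..<int N}. f k) = (\<Sum>j<N. f (- 1 - int j) + f (int j))"
  proof (induction N)
    case (Suc N)
    have "{- int (Suc N)..<int (Suc N)} = insert (- 1 - int N) (insert (int N) {- int N..<int N})"
      by auto
    thus ?case using Suc by (simp add: add_ac)
  qed simp
  ultimately show ?thesis by simp
qed

lemma field_prod_id_minus_one:
  assumes "\<And>n. a n 0 = 0"
  shows "field_prod 1 a (-1) id_field m v = a m v"
proof -
  define g where "g k = (if k = m then a m v else 0)" for k
  have "{k. g k \<noteq> 0} \<subseteq> {m}" by (auto simp: g_def)
  hence fin: "finite {k. g k \<noteq> 0}" by (rule finite_subset) simp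
  have 1: "a (- 1 - int j) (id_field (m + int j) v) = g (- 1 - int j)" for j
  proof (cases "m + int j = -1")
    case True
    hence m: "m = - 1 - int j" by simp
    show ?thesis unfolding g_def m by (simp add: id_field_def)
  qed (auto simp: id_field_def g_def assms)
  have 2: "id_field (m - 1 - int j) (a (int j) v) = g (int j)" for j
    by (auto simp: id_field_def g_def)
  have "field_prod 1 a (-1) id_field m v = Sum_any g"
    unfolding field_prod_minus_one 1 2 by (rule Sum_any_int_split[OF fin])
  also have "\<dots> = a m v" by (simp add: g_def[abs_def])
  finally show ?thesis .
qed

lemma field_prod_id_minus_two:
  assumes "\<And>n. a n 0 = 0"
  shows "field_prod 1 a (-2) id_field m v = cscale (- of_int m) (a (m - 1) v)"
proof -
  define h where "h = cscale (- of_int m) (a (m - 1) v)"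
  have e: "(-1 :: complex) ^ j * ((-1) ^ j * of_nat (j + 1)) = of_nat (j + 1)" for j
    by (rule minus_one_sq)
  have p: "(-1 :: complex) powi (-2) = 1" by (simp add: power_int_minus)
  have t: "cscale (of_nat (j + 1)) (a (- 2 - int j) (id_field (m + int j) v)
       - id_field (m - 2 - int j) (a (int j) v)) =
     (if j = (if m < 0 then nat (- 1 - m) else nat (m - 1)) then h else 0)" for j
  proof -
    consider "m + int j = -1" | "m - 1 = int j" | "m + int j \<noteq> -1" "m - 1 \<noteq> int j" by blast
    thus ?thesis
    proof cases
      case 1
      hence "m = - 1 - int j" by simp
      thus ?thesis by (simp add: id_field_def h_def)
    next
      case 2
      hence m: "m = 1 + int j" by simp
      show ?thesis by (simp add: m id_field_def h_def assms flip: pm.scale_minus_left)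
    next
      case 3
      hence ne: "m - 2 - int j \<noteq> -1" by auto
      have "j = nat (m - 1) \<Longrightarrow> \<not> m < 0 \<Longrightarrow> h = 0" using 3 by (cases "m = 0") (auto simp: h_def)
      moreover have "j = nat (- 1 - m) \<Longrightarrow> \<not> m < 0" using 3 by auto
      ultimately have "(if j = (if m < 0 then nat (- 1 - m) else nat (m - 1)) then h else 0) = 0"
        by presburger
      thus ?thesis using 3 ne by (simp only: id_field_def assms if_False refl diff_0_right pm.scale_zero_right)
    qed
  qed
  have "field_prod 1 a (-2) id_field m v = Sum_any (\<lambda>j. 
      cscale (of_nat (j + 1)) (a (- 2 - int j) (id_field (m + int j) v)
       - id_field (m - 2 - int j) (a (int j) v)))"
    unfolding field_prod_def using e p by (simp add: minus_two_gchoose algebra_simps del: of_nat_add of_nat_Suc)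
  also have "\<dots> = h" unfolding t by simp
  finally show ?thesis by (simp add: h_def)
qed

lemma gamma_chi_zero [simp]: "gamma_chi \<chi>p \<chi>m s n 0 = 0"
  by (simp add: gamma_chi_def)

lemma tau_eq:
  "tau s = Poly_Mapping.single ({|(s, 1)|}, {#}) 1 + Poly_Mapping.single ({|(s, 0)|}, {#(s, 0)#}) 1"
  by (simp add: tau_def vac_def psi_FM_def gamma_FM_def psi_basis_def create_def gamma_basis_def
       tensor_def pass_sign_def)

lemma mode_of_eventually_zero: "\<exists>N. \<forall>n\<ge>N. mode_of \<chi> n = 0"
  by (rule exI[of _ "- fls_subdegree \<chi>"]) (auto simp: mode_of_def)

lemma sorted_list_of_fset_single: "sorted_list_of_fset {|x|} = [x]"
  by (simp add: sorted_list_of_fset.rep_eq)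

text \<open>
  The action of the generators of \<open>\<V>\<close>: the mode \<open>(\<tau>\<^sup>\<plusminus>)\<^sub>i\<close> is \<open>G\<^sup>\<plusminus>(i-1/2)\<close>, and \<open>j\<close>, \<open>\<nu>\<close> act by scalar series.
\<close>

lemma Y_F_tau:
  "Y_F \<chi>p \<chi>m (tau s) i v = cscale (- of_int i) (psi s (i - 1) v) +
     Sum_any (\<lambda>k. cscale (mode_of (if s then \<chi>p else \<chi>m) (- k)) (psi s (k + i - 1) v))"
proof -
  define c where "c = mode_of (if s then \<chi>p else \<chi>m)"
  define f where "f k = cscale (c (i - 1 - k)) (psi s k v)" for k
  obtain N where N: "\<And>n. n \<ge> N \<Longrightarrow> psi s n v = 0" using psi_eventually_zero by metis
  obtain M where M: "\<And>n. n \<ge> M \<Longrightarrow> c n = 0" using mode_of_eventually_zero c_def by metis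
  have "{k. f k \<noteq> 0} \<subseteq> {i - 1 - M..N}"
  proof
    fix k assume "k \<in> {k. f k \<noteq> 0}"
    hence "c (i - 1 - k) \<noteq> 0" "psi s k v \<noteq> 0" by (auto simp: f_def)
    with N[of k] M[of "i - 1 - k"] show "k \<in> {i - 1 - M..N}" by force
  qed
  hence fin: "finite {k. f k \<noteq> 0}" by (rule finite_subset) simp
  have g: "field_prod 1 (gamma_chi \<chi>p \<chi>m s) (-1) id_field = gamma_chi \<chi>p \<chi>m s"
    by (intro ext field_prod_id_minus_one) simp
  have "field_prod 1 (psi s) (-1) (gamma_chi \<chi>p \<chi>m s) i v = 
      Sum_any (\<lambda>j. f (- 1 - int j) + f (int j))"
    unfolding field_prod_minus_one by (simp add: f_def gamma_chi_def c_def)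
  also have "\<dots> = Sum_any f" by (rule Sum_any_int_split[OF fin])
  also have "\<dots> = Sum_any (\<lambda>k. f (k + i - 1))"
  proof -
    have "bij (\<lambda>k::int. k + i - 1)" by (rule bij_betw_byWitness[of _ "\<lambda>k. k - i + 1"]) auto
    thus ?thesis by (intro Sum_any.reindex_cong[of "\<lambda>k. k + i - 1"]) (auto simp: fun_eq_iff)
  qed
  finally have "field_prod 1 (psi s) (-1) (gamma_chi \<chi>p \<chi>m s) i v =
      Sum_any (\<lambda>k. cscale (c (- k)) (psi s (k + i - 1) v))"
    by (simp add: f_def algebra_simps)
  thus ?thesis
    by (simp add: Y_F_def vertex_op_def tau_eq lin_ext_add sorted_list_of_fset_single g 
         field_prod_id_minus_two c_def[symmetric])
qed

lemma gamma_chi_field_prod: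
  "field_prod 1 (gamma_chi \<chi>p \<chi>m s) (-1) (gamma_chi \<chi>p \<chi>m t) m v =
     cscale (mode_of ((if s then \<chi>p else \<chi>m) * (if t then \<chi>p else \<chi>m)) m) v"
proof -
  define g h where "g = (if s then \<chi>p else \<chi>m)" and "h = (if t then \<chi>p else \<chi>m)"
  define F where "F i = cscale (fls_nth g i * fls_nth h (- m - 1 - i)) v" for i
  define f where "f k = F (- k - 1)" for k
  let ?I = "{fls_subdegree g..- m - 1 - fls_subdegree h}"
  have F0: "{i. F i \<noteq> 0} \<subseteq> ?I"
  proof
    fix i assume "i \<in> {i. F i \<noteq> 0}"
    hence "fls_nth g i \<noteq> 0" "fls_nth h (- m - 1 - i) \<noteq> 0" by (auto simp: F_def)
    hence "i \<ge> fls_subdegree g" "- m - 1 - i \<ge> fls_subdegree h"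
      by (auto intro: fls_subdegree_leI)
    thus "i \<in> ?I" by auto
  qed
  have "{k. f k \<noteq> 0} \<subseteq> (\<lambda>i. - i - 1) ` {i. F i \<noteq> 0}"
    by (force simp: f_def image_iff intro: exI[of _ "- _ - 1"])
  moreover have "finite {i. F i \<noteq> 0}" by (rule finite_subset[OF F0]) simp
  ultimately have fin: "finite {k. f k \<noteq> 0}" by (meson finite_imageI finite_subset)
  have "field_prod 1 (gamma_chi \<chi>p \<chi>m s) (-1) (gamma_chi \<chi>p \<chi>m t) m v =
      Sum_any (\<lambda>j. f (- 1 - int j) + f (int j))"
    unfolding field_prod_minus_one
    by (simp add: f_def F_def gamma_chi_def mode_of_def g_def h_def mult.commute algebra_simps)
  also have "\<dots> = Sum_any f" by (rule Sum_any_int_split[OF fin])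
  also have "\<dots> = Sum_any F"
  proof -
    have "bij (\<lambda>k::int. - k - 1)" by (rule bij_betw_byWitness[of _ "\<lambda>k. - k - 1"]) auto
    thus ?thesis by (intro Sum_any.reindex_cong[of "\<lambda>k. - k - 1"]) (auto simp: f_def fun_eq_iff)
  qed
  also have "\<dots> = (\<Sum>i\<in>?I. F i)" by (rule Sum_any.expand_superset[OF _ F0]) simp
  also have "\<dots> = cscale (mode_of (g * h) m) v"
    by (simp add: F_def mode_of_def fls_times_nth(2) pm.scale_sum_left)
  finally show ?thesis by (simp add: g_def h_def)
qed

lemma Y_F_jvec:
  "Y_F \<chi>p \<chi>m jvec n v = cscale (mode_of (fls_const (1/2) * (\<chi>p - \<chi>m)) n) v"
proof -
  have g: "field_prod 1 (gamma_chi \<chi>p \<chi>m s) (-1) id_field = gamma_chi \<chi>p \<chi>m s" for s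
    by (intro ext field_prod_id_minus_one) simp
  have j: "jvec = cscale (1/2) (Poly_Mapping.single ({||}, {#(True, 0)#}) 1)
    + cscale (- 1/2) (Poly_Mapping.single ({||}, {#(False, 0)#}) 1)"
    by (rule poly_mapping_eqI)
       (simp add: jvec_def vac_def gamma_FM_def gamma_basis_def tensor_def lookup_add lookup_minus
          lookup_single when_def)
  show ?thesis
    by (rule poly_mapping_eqI)
       (simp add: Y_F_def vertex_op_def j lin_ext_add lin_ext_cscale sorted_list_of_fset.rep_eq g gamma_chi_def
          mode_of_def lookup_add lookup_minus field_simps)
qed

lemma Y_F_nuvec:
  "Y_F \<chi>p \<chi>m nuvec n v =
     cscale (mode_of (fls_const (1/4) * (2 * \<chi>p * \<chi>m + fls_deriv \<chi>p + fls_deriv \<chi>m)) n) v"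
proof -
  have g: "field_prod 1 (gamma_chi \<chi>p \<chi>m s) (-1) id_field = gamma_chi \<chi>p \<chi>m s" for s
    by (intro ext field_prod_id_minus_one) simp
  have nu: "nuvec = cscale (1/2) (Poly_Mapping.single ({||}, {#(True, 0), (False, 0)#}) 1)
    + cscale (1/4) (Poly_Mapping.single ({||}, {#(True, 1)#}) 1)
    + cscale (1/4) (Poly_Mapping.single ({||}, {#(False, 1)#}) 1)"
    by (simp add: nuvec_def vac_def gamma_FM_def gamma_basis_def tensor_def pm.scale_right_distrib)
  have d: "mode_of (fls_deriv \<chi>) n = - of_int n * mode_of \<chi> (n - 1)" for \<chi>
    by (simp add: mode_of_def)
  have m: "mode_of (fls_const (1/4) * (2 * \<chi>p * \<chi>m + fls_deriv \<chi>p + fls_deriv \<chi>m)) n =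
     mode_of (\<chi>m * \<chi>p) n / 2 + mode_of (fls_deriv \<chi>p) n / 4 + mode_of (fls_deriv \<chi>m) n / 4"
  proof -
    have "2 * \<chi>p * \<chi>m = \<chi>m * \<chi>p + \<chi>m * \<chi>p" by (simp add: mult_2 distrib_right mult.commute)
    thus ?thesis by (simp only: mode_of_def fls_mult_const_nth fls_plus_nth) simp
  qed
  have w: "sorted_list_of_multiset {#(True, 0::nat), (False, 0)#} = [(False, 0), (True, 0)]"
    by simp
  have "Y_F \<chi>p \<chi>m nuvec n v =
      cscale (1/2) (cscale (mode_of (\<chi>m * \<chi>p) n) v)
      + cscale (1/4) (cscale (- of_int n) (gamma_chi \<chi>p \<chi>m True (n - 1) v))
      + cscale (1/4) (cscale (- of_int n) (gamma_chi \<chi>p \<chi>m False (n - 1) v))"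
    by (simp del: sorted_list_of_multiset_insert cscale_single add: w Y_F_def vertex_op_def nu lin_ext_add lin_ext_cscale sorted_list_of_fset.rep_eq g
          field_prod_id_minus_two gamma_chi_field_prod)
  also have "\<dots> = cscale (mode_of (\<chi>m * \<chi>p) n / 2 + mode_of (fls_deriv \<chi>p) n / 4 + mode_of (fls_deriv \<chi>m) n / 4) v"
    by (simp add: gamma_chi_def d pm.scale_left_distrib pm.scale_left_diff_distrib)
  finally show ?thesis unfolding m .
qed

end

theory Submission
  imports Defs
begin

text \<open>
  The action of the Clifford algebra on \<open>F\<close>, under which \<open>F\<close> is irreducible, can be recovered from
  the modes of the odd generators \<open>\<tau>\<^sup>\<plusminus>\<close>.

  The mode \<open>(\<tau>\<^sup>\<plusminus>)\<^sub>i\<close> acts on \<open>F\<close> as a combination of \<open>\<Psi>\<^sup>\<plusminus>(m+1/2)\<close> over \<open>m \<ge> i - 1 - p\<close>, where \<open>p\<close> is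
  the order of the highest nonvanishing mode of \<open>\<chi>\<^sup>\<plusminus>\<close>. The lowest term has the coefficient \<open>\<chi>\<^sub>p\<close> if
  \<open>p > 0\<close>, and \<open>\<chi>\<^sub>0 - i\<close> if \<open>p = 0\<close>, because then the term \<open>-i \<Psi>\<^sup>\<plusminus>(i-1/2)\<close> contributes in the same
  place. It never vanishes; for \<open>p = 0\<close> this is the
  condition \<open>\<chi>\<^sub>0 \<notin> \<int>\<close>. Now let \<open>v\<close> lie in a submodule.
  Since \<open>\<Psi>\<^sup>\<plusminus>(m+1/2) v = 0\<close> for large \<open>m\<close>, this triangular system can be solved by descending
  induction on \<open>m\<close>, so every \<open>\<Psi>\<^sup>\<plusminus>(m+1/2) v\<close> lies in the submodule
  (\<open>tau_closed_imp_psi_closed\<close>). The series \<open>\<lambda>/z\<close> is an instance with \<open>p = 0\<close>, so the same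
  argument serves both signs.

  A nonzero subspace of \<open>F\<close> that is stable under the Clifford algebra is all of \<open>F\<close>
  (\<open>psi_closed_imp_UNIV\<close>): annihilation operators take a nonzero vector to a nonzero multiple of the
  vacuum, and creation operators take the vacuum to each basis vector.
\<close>

definition psi_closed :: "F_space set \<Rightarrow> bool" where
  "psi_closed W \<longleftrightarrow> (\<forall>s n. \<forall>w\<in>W. psi s n w \<in> W)"

lemma psi_annihilate: "psi (\<not> t) (int k) v = lin_ext (annihilate (t, k)) v"
  by (simp add: psi_def psi_basis_def[abs_def])

lemma psi_create: "psi t (- int k - 1) v = lin_ext (create (t, k)) v"
  by (simp add: psi_def psi_basis_def[abs_def])

text \<open>
  On coefficients an annihilation operator is a shift up to signs. Hence it kills no vector in which
  its label occurs, and it removes that label from every basis vector.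
\<close>

lemma lookup_annihilate:
  "Poly_Mapping.lookup (lin_ext (annihilate x) v) B =
     (if x |\<in>| B then 0 else pass_sign x B * Poly_Mapping.lookup v (finsert x B))"
proof -
  have *: "Poly_Mapping.lookup (annihilate x A) B =
      (if A = finsert x B \<and> x |\<notin>| B then pass_sign x B else 0)" for A
  proof (cases "x |\<in>| A")
    case True
    then have "A |-| {|x|} = B \<longleftrightarrow> A = finsert x B \<and> x |\<notin>| B" by auto
    then show ?thesis
      using True by (auto simp: annihilate_def lookup_single when_def pass_sign_insert)
  qed (auto simp: annihilate_def)
  have "Poly_Mapping.lookup (lin_ext (annihilate x) v) B =
      (\<Sum>A\<in>Poly_Mapping.keys v. Poly_Mapping.lookup v A *
         (if A = finsert x B \<and> x |\<notin>| B then pass_sign x B else 0))"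
    by (simp add: lin_ext_def lookup_sum *)
  also have "\<dots> = (if x |\<in>| B then 0 else pass_sign x B * Poly_Mapping.lookup v (finsert x B))"
    by (auto simp: if_distrib in_keys_iff sum.delta cong: if_cong)
  finally show ?thesis .
qed

text \<open>
  The induction is on the number of labels that occur in the vector; a vector in which no label
  occurs is a multiple of the vacuum.
\<close>

lemma psi_closed_imp_vacuum_mem:
  assumes W: "pm.subspace W" "psi_closed W" and "v \<in> W" "v \<noteq> 0"
  shows "Poly_Mapping.single {||} 1 \<in> W"
  using assms(3,4)
proof (induction "card (\<Union>A\<in>Poly_Mapping.keys v. fset A)" arbitrary: v rule: less_induct)
  case less
  let ?L = "\<lambda>v :: F_space. \<Union>A\<in>Poly_Mapping.keys v. fset A"
  show ?case
  proof (cases "?L v = {}")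
    case True
    then have k: "A = {||}" if "A \<in> Poly_Mapping.keys v" for A
      using that by (force simp: fset_eq_iff)
    have v: "v = Poly_Mapping.single {||} (Poly_Mapping.lookup v {||})"
      by (rule poly_mapping_eqI) (metis in_keys_iff k lookup_single_eq lookup_single_not_eq)
    then have c: "Poly_Mapping.lookup v {||} \<noteq> 0" using less.prems(2) by force
    have "cscale (inverse (Poly_Mapping.lookup v {||})) v \<in> W"
      using W(1) less.prems(1) by (rule pm.subspace_scale)
    moreover have "cscale (inverse (Poly_Mapping.lookup v {||})) v = Poly_Mapping.single {||} 1"
      by (subst (2) v) (simp add: c)
    ultimately show ?thesis by simp
  next
    case False
    then obtain A x where A: "A \<in> Poly_Mapping.keys v" "x |\<in>| A" by auto
    obtain t k where x: "x = (t, k)" by (cases x)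
    let ?u = "lin_ext (annihilate x) v"
    have u: "?u \<in> W"
      using W(2) less.prems(1) by (simp add: psi_closed_def x flip: psi_annihilate)
    have sign: "pass_sign x B \<noteq> 0" for B by (simp add: pass_sign_def)
    have "finsert x (A |-| {|x|}) = A" using A(2) by auto
    then have "Poly_Mapping.lookup ?u (A |-| {|x|}) \<noteq> 0"
      using A(1) sign by (simp add: lookup_annihilate in_keys_iff)
    then have "?u \<noteq> 0" by auto
    moreover have "?L ?u \<subseteq> ?L v - {x}"
    proof
      fix y assume "y \<in> ?L ?u"
      then obtain B where B: "B \<in> Poly_Mapping.keys ?u" "y \<in> fset B" by blast
      then have "x \<notin> fset B" "finsert x B \<in> Poly_Mapping.keys v"
        by (simp_all add: in_keys_iff lookup_annihilate split: if_splits)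
      with B(2) show "y \<in> ?L v - {x}" by auto
    qed
    then have "?L ?u \<subset> ?L v" using A by blast
    then have "card (?L ?u) < card (?L v)" by (intro psubset_card_mono) auto
    ultimately show ?thesis using less.hyps u by blast
  qed
qed

lemma psi_closed_imp_UNIV:
  assumes W: "pm.subspace W" "psi_closed W" and "W \<noteq> {0}"
  shows "W = UNIV"
proof -
  have "0 \<in> W" using W(1) by (rule pm.subspace_0)
  with assms(3) obtain v where "v \<in> W" "v \<noteq> 0" by blast
  then have vac: "Poly_Mapping.single {||} 1 \<in> W"
    using W psi_closed_imp_vacuum_mem by blast
  have basis: "Poly_Mapping.single A 1 \<in> W" for A
  proof (induction A)
    case empty
    show ?case by (rule vac)
  next
    case (insert x A)
    obtain t k where x: "x = (t, k)" by (cases x)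
    have "lin_ext (create x) (Poly_Mapping.single A 1) \<in> W"
      using W(2) insert.IH by (simp only: psi_closed_def x flip: psi_create)
    then have "Poly_Mapping.single (finsert x A) (pass_sign x A) \<in> W"
      using insert.hyps by (simp add: create_def)
    then have "cscale (pass_sign x A) (Poly_Mapping.single (finsert x A) (pass_sign x A)) \<in> W"
      by (rule pm.subspace_scale[OF W(1)])
    then show ?case by simp
  qed
  have "lin_ext (\<lambda>A. Poly_Mapping.single A 1) w \<in> W" for w
    unfolding lin_ext_def using W(1) basis
    by (intro pm.subspace_sum pm.subspace_scale) auto
  then show ?thesis by auto
qed

text \<open>
  On a fixed vector \<open>v\<close> only finitely many terms of the series \<open>\<chi>\<close> act nontrivially, so that
  \<open>(\<tau>\<^sup>\<plusminus>)\<^sub>i v\<close> is a finite combination of the \<open>\<Psi>\<^sup>\<plusminus>(m+1/2) v\<close>. It can be solved for the one with the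
  lowest \<open>m\<close>, as the others are in the subspace already.
\<close>

lemma tau_closed_imp_psi_closed:
  fixes \<chi>p \<chi>m :: "complex fls" and p :: nat
  defines "\<chi> s \<equiv> (if s then \<chi>p else \<chi>m)"
  assumes W: "pm.subspace W"
    and tau: "\<And>i. Y_F \<chi>p \<chi>m (tau s) i v \<in> W"
    and high: "\<And>n. n > int p \<Longrightarrow> mode_of (\<chi> s) n = 0"
    and lead: "mode_of (\<chi> s) (int p) \<noteq> 0"
    and nonint: "p = 0 \<Longrightarrow> mode_of (\<chi> s) 0 \<notin> \<int>"
  shows "psi s m v \<in> W"
proof -
  obtain N where N: "\<And>n. n \<ge> N \<Longrightarrow> psi s n v = 0"
    using psi_eventually_zero by metis
  have "\<forall>n\<ge>m. psi s n v \<in> W"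
  proof (cases "m \<le> N")
    case False
    then show ?thesis using N pm.subspace_0[OF W] by auto
  next
    case True
    then show ?thesis
    proof (induction m rule: int_le_induct)
      case base
      show ?case using N pm.subspace_0[OF W] by auto
    next
      case (step m)
      \<comment> \<open>the mode of \<open>\<tau>\<^sup>\<plusminus>\<close> whose lowest term is \<open>\<Psi>\<^sup>\<plusminus>(m-1/2)\<close>, since \<open>- p + i - 1 = m - 1\<close>\<close>
      define i where "i = m + int p"
      define f where "f k = cscale (mode_of (\<chi> s) (- k)) (psi s (k + i - 1) v)" for k
      have sub: "{k. f k \<noteq> 0} \<subseteq> insert (- int p) {- int p<..N - i + 1}"
      proof
        fix k assume "k \<in> {k. f k \<noteq> 0}"
        then have "mode_of (\<chi> s) (- k) \<noteq> 0" "psi s (k + i - 1) v \<noteq> 0"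
          by (auto simp: f_def)
        with high[of "- k"] N[of "k + i - 1"] show "k \<in> insert (- int p) {- int p<..N - i + 1}"
          by force
      qed
      define R where "R = (\<Sum>k\<in>{- int p<..N - i + 1}. f k)"
      have R: "R \<in> W"
        unfolding R_def f_def using step.IH
        by (intro pm.subspace_sum[OF W] pm.subspace_scale[OF W]) (auto simp: i_def)
      have "Sum_any f = f (- int p) + R"
        unfolding R_def by (subst Sum_any.expand_superset[OF _ sub]) auto
      then have Y: "Y_F \<chi>p \<chi>m (tau s) i v = cscale (- of_int i) (psi s (i - 1) v) + (f (- int p) + R)"
        by (simp add: Y_F_tau f_def[abs_def] \<chi>_def)
      have f: "f (- int p) = cscale (mode_of (\<chi> s) (int p)) (psi s (m - 1) v)"
        by (simp add: f_def i_def algebra_simps)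
      have "\<exists>c. c \<noteq> 0 \<and> cscale c (psi s (m - 1) v) \<in> W"
      proof (cases "p = 0")
        case True
        define c where "c = mode_of (\<chi> s) 0 - of_int m"
        have "c \<noteq> 0" using nonint[OF True] by (auto simp: c_def)
        moreover have "cscale c (psi s (m - 1) v) = Y_F \<chi>p \<chi>m (tau s) i v - R"
          unfolding Y f using True by (simp add: c_def i_def pm.scale_left_diff_distrib)
        ultimately show ?thesis using pm.subspace_diff[OF W tau R] by metis
      next
        case False
        have low: "cscale (- of_int i) (psi s (i - 1) v) \<in> W"
          using False step.IH by (intro pm.subspace_scale[OF W]) (simp add: i_def)
        have "cscale (mode_of (\<chi> s) (int p)) (psi s (m - 1) v) =
            Y_F \<chi>p \<chi>m (tau s) i v - cscale (- of_int i) (psi s (i - 1) v) - R"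
          unfolding Y f by simp
        then show ?thesis using lead pm.subspace_diff[OF W pm.subspace_diff[OF W tau low] R] by metis
      qed
      then obtain c where "c \<noteq> 0" "cscale c (psi s (m - 1) v) \<in> W" by blast
      then have "psi s (m - 1) v \<in> W"
        using pm.subspace_scale[OF W, of "cscale c (psi s (m - 1) v)" "inverse c"] by simp
      then show ?case using step.IH by (metis diff_add_cancel order_le_less zle_diff1_eq not_le)
    qed
  qed
  then show ?thesis by simp
qed

theorem proposition5p1:
  fixes lam :: complex and p :: nat and \<chi> :: "complex fls"
  assumes "lam \<notin> \<int>"
    and "\<And>n. n > int p \<Longrightarrow> mode_of \<chi> n = 0"
    and "mode_of \<chi> (int p) \<noteq> 0"
    and "p = 0 \<Longrightarrow> mode_of \<chi> 0 \<notin> \<int>"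
  shows "irreducible_under calV (Y_F (fls_const lam / fls_X) \<chi>)"
proof -
  define L where "L = fls_const lam / fls_X"
  have mode_L: "mode_of L n = (if n = 0 then lam else 0)" for n
    by (simp add: L_def mode_of_def fls_divide_convert_times_inverse fls_inverse_X fls_X_inv_times_conv_shift)
  have tau_calV: "tau s \<in> calV" for s
    unfolding calV_def by (cases s) (auto intro: hull_inc)
  have "W = {0} \<or> W = UNIV" if sm: "submodule_under calV (Y_F L \<chi>) W" for W
  proof -
    have W: "pm.subspace W" using sm by (simp add: submodule_under_def)
    have t: "Y_F L \<chi> (tau s) i w \<in> W" if "w \<in> W" for s i w
      using sm that tau_calV by (simp add: submodule_under_def)
    have "psi s n w \<in> W" if "w \<in> W" for s n w
    proof (cases s)
      case True
      show ?thesis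
        by (rule tau_closed_imp_psi_closed[OF W t[OF that], of 0])
           (use assms(1) True in \<open>auto simp: mode_L\<close>)
    next
      case False
      show ?thesis
        by (rule tau_closed_imp_psi_closed[OF W t[OF that], of p])
           (use assms(2-4) False in auto)
    qed
    then show ?thesis
      using psi_closed_imp_UNIV[OF W] by (auto simp: psi_closed_def)
  qed
  moreover have "Poly_Mapping.single {||} 1 \<noteq> (0 :: F_space)"
    by (metis lookup_single_eq lookup_zero one_neq_zero)
  ultimately show ?thesis unfolding irreducible_under_def L_def by blast
qed

end
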